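(* Let $a,b\in\mathbb{H}_s$. Then $$L(a)L(a^+)L(a)=L(a),\quad L(a^+)L(a)L(a^+)=L(a^+),\quad L(a)L(a^+)=\big(L(a)L(a^+)\big)^*,\quad L(a^+)L(a)=\big(L(a^+)L(a)\big)^*;$$ $$R(a)R(a^+)R(a)=R(a),\quad R(a^+)R(a)R(a^+)=R(a^+),\quad R(a)R(a^+)=\big(R(a)R(a^+)\big)^*,\quad R(a^+)R(a)=\big(R(a^+)R(a)\big)^*;$$ and $$L(a)^+=L(a^+),\qquad R(b)^+=R(b^+),\qquad \big(L(a)R(b)\big)^+=L(a^+)R(b^+).$$
   Context: $\mathbb{H}_s=\{q_0+q_1\mathbf{i}+q_2\mathbf{j}+q_3\mathbf{k}: q_i\in\mathbb{R}\}$ is the real associative algebra of split quaternions with $\mathbf{i}^2=-1$, $\mathbf{j}^2=\mathbf{k}^2=1$, $\mathbf{i}\mathbf{j}=\mathbf{k}=-\mathbf{j}\mathbf{i}$, $\mathbf{j}\mathbf{k}=-\mathbf{i}=-\mathbf{k}\mathbf{j}$, $\mathbf{k}\mathbf{i}=\mathbf{j}=-\mathbf{i}\mathbf{k}$. $\mathbb{R}+\mathbb{R}\mathbf{i}$ is identified with $\mathbb{C}$; every $q$ is uniquely $z_1+z_2\mathbf{j}$ with $z_1=q_0+q_1\mathbf{i}$, $z_2=q_2+q_3\mathbf{i}\in\mathbb{C}$. $L(q)$ and $R(q)$ are the matrices in the basis $1,\mathbf{i},\mathbf{j},\mathbf{k}$ of $x\mapsto qx$ and $x\mapsto xq$: $$L(q)=\begin{pmatrix}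 q_0&-q_1&q_2&q_3\\ q_1&q_0&q_3&-q_2\\ q_2&q_3&q_0&-q_1\\ q_3&-q_2&q_1&q_0\end{pmatrix},\quad R(q)=\begin{pmatrix} q_0&-q_1&q_2&q_3\\ q_1&q_0&-q_3&q_2\\ q_2&-q_3&q_0&q_1\\ q_3&q_2&-q_1&q_0\end{pmatrix}.$$ The Moore-Penrose inverse of $a=c_1+c_2\mathbf{j}\in\mathbb{H}_s$ ($c_1,c_2\in\mathbb{C}$) is defined by $a^+=0$ if $a=0$; $a^+=\frac{\overline{c_1}-c_2\mathbf{j}}{|c_1|^2-|c_2|^2}$ if $|c_1|^2-|c_2|^2\neq0$; $a^+=\frac{\overline{c_1}+c_2\mathbf{j}}{4|c_1|^2}$ if $a\ne0$ and $|c_1|^2-|c_2|^2=0$. For a matrix $A$, $A^*$ is the conjugate transpose and $A^+$ is the usual Moore-Penrose inverse, i.e. the unique $X$ with $AXA=A$, $XAX=X$, $(AX)^*=AX$, $(XA)^*=XA$. *)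

theory Defs
  imports "HOL-Analysis.Analysis" "Jordan_Normal_Form.Conjugate"
begin

section \<open>Split quaternions\<close>

codatatype squat = Squat (sq0: real) (sq1: real) (sq2: real) (sq3: real)

lemma squat_eqI:
  "sq0 p = sq0 q \<Longrightarrow> sq1 p = sq1 q \<Longrightarrow> sq2 p = sq2 q \<Longrightarrow> sq3 p = sq3 q \<Longrightarrow> p = q"
  by (rule squat.expand) simp

lemma squat_eq_iff:
  "p = q \<longleftrightarrow> sq0 p = sq0 q \<and> sq1 p = sq1 q \<and> sq2 p = sq2 q \<and> sq3 p = sq3 q"
  by (auto intro: squat_eqI)

instantiation squat :: real_algebra_1
begin

primcorec zero_squat where
  "sq0 0 = 0" | "sq1 0 = 0" | "sq2 0 = 0" | "sq3 0 = 0"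

primcorec one_squat where
  "sq0 1 = 1" | "sq1 1 = 0" | "sq2 1 = 0" | "sq3 1 = 0"

primcorec plus_squat where
  "sq0 (p + q) = sq0 p + sq0 q"
| "sq1 (p + q) = sq1 p + sq1 q"
| "sq2 (p + q) = sq2 p + sq2 q"
| "sq3 (p + q) = sq3 p + sq3 q"

primcorec uminus_squat where
  "sq0 (- p) = - sq0 p"
| "sq1 (- p) = - sq1 p"
| "sq2 (- p) = - sq2 p"
| "sq3 (- p) = - sq3 p"

primcorec minus_squat where
  "sq0 (p - q) = sq0 p - sq0 q"
| "sq1 (p - q) = sq1 p - sq1 q"
| "sq2 (p - q) = sq2 p - sq2 q"
| "sq3 (p - q) = sq3 p - sq3 q"

primcorec scaleR_squat where
  "sq0 (r *\<^sub>R p) = r * sq0 p"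
| "sq1 (r *\<^sub>R p) = r * sq1 p"
| "sq2 (r *\<^sub>R p) = r * sq2 p"
| "sq3 (r *\<^sub>R p) = r * sq3 p"

text \<open>The bilinear extension of the multiplication table of \<open>1, i, j, k\<close>, which is
  verified below in \<open>squat_mult_table\<close>.\<close>

primcorec times_squat where
  "sq0 (p * q) = sq0 p * sq0 q - sq1 p * sq1 q + sq2 p * sq2 q + sq3 p * sq3 q"
| "sq1 (p * q) = sq1 p * sq0 q + sq0 p * sq1 q + sq3 p * sq2 q - sq2 p * sq3 q"
| "sq2 (p * q) = sq2 p * sq0 q + sq3 p * sq1 q + sq0 p * sq2 q - sq1 p * sq3 q"
| "sq3 (p * q) = sq3 p * sq0 q - sq2 p * sq1 q + sq1 p * sq2 q + sq0 p * sq3 q"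

instance
  by standard (simp_all add: squat_eq_iff algebra_simps)

end

definition sqi :: squat where "sqi = Squat 0 1 0 0"
definition sqj :: squat where "sqj = Squat 0 0 1 0"
definition sqk :: squat where "sqk = Squat 0 0 0 1"

lemma squat_mult_table:
  "sqi * sqi = - 1" "sqj * sqj = 1" "sqk * sqk = 1"
  "sqi * sqj = sqk" "sqj * sqi = - sqk"
  "sqj * sqk = - sqi" "sqk * sqj = sqi"
  "sqk * sqi = sqj" "sqi * sqk = - sqj"
  by (simp_all add: squat_eq_iff sqi_def sqj_def sqk_def)

lemma squat_expansion:
  "q = of_real (sq0 q) + sq1 q *\<^sub>R sqi + sq2 q *\<^sub>R sqj + sq3 q *\<^sub>R sqk"
  by (simp add: squat_eq_iff sqi_def sqj_def sqk_def of_real_def)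

definition sq_of_complex :: "complex \<Rightarrow> squat" where
  "sq_of_complex z = of_real (Re z) + Im z *\<^sub>R sqi"

text \<open>The complex numbers \<open>z\<^sub>1\<close>, \<open>z\<^sub>2\<close> in the decomposition \<open>q = z\<^sub>1 + z\<^sub>2 j\<close>.\<close>

definition cpart1 :: "squat \<Rightarrow> complex" where
  "cpart1 q = Complex (sq0 q) (sq1 q)"

definition cpart2 :: "squat \<Rightarrow> complex" where
  "cpart2 q = Complex (sq2 q) (sq3 q)"

lemma squat_complex_decomposition:
  "q = sq_of_complex z1 + sq_of_complex z2 * sqj \<longleftrightarrow> z1 = cpart1 q \<and> z2 = cpart2 q"
  by (auto simp: squat_eq_iff complex_eq_iff sq_of_complex_def cpart1_def cpart2_def
      sqi_def sqj_def of_real_def)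

definition sq_pinv :: "squat \<Rightarrow> squat" where
  "sq_pinv a = (let c1 = cpart1 a; c2 = cpart2 a in
     if a = 0 then 0
     else if (cmod c1)\<^sup>2 - (cmod c2)\<^sup>2 \<noteq> 0
     then (sq_of_complex (cnj c1) - sq_of_complex c2 * sqj) /\<^sub>R ((cmod c1)\<^sup>2 - (cmod c2)\<^sup>2)
     else (sq_of_complex (cnj c1) + sq_of_complex c2 * sqj) /\<^sub>R (4 * (cmod c1)\<^sup>2))"

section \<open>The matrices of left and right multiplication\<close>

definition Lmat :: "squat \<Rightarrow> real ^ 4 ^ 4" where
  "Lmat q = vector
    [vector [sq0 q, - sq1 q,   sq2 q,   sq3 q],
     vector [sq1 q,   sq0 q,   sq3 q, - sq2 q],
     vector [sq2 q,   sq3 q,   sq0 q, - sq1 q],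
     vector [sq3 q, - sq2 q,   sq1 q,   sq0 q]]"

definition Rmat :: "squat \<Rightarrow> real ^ 4 ^ 4" where
  "Rmat q = vector
    [vector [sq0 q, - sq1 q,   sq2 q,   sq3 q],
     vector [sq1 q,   sq0 q, - sq3 q,   sq2 q],
     vector [sq2 q, - sq3 q,   sq0 q,   sq1 q],
     vector [sq3 q,   sq2 q, - sq1 q,   sq0 q]]"

definition sq_coords :: "squat \<Rightarrow> real ^ 4" where
  "sq_coords q = vector [sq0 q, sq1 q, sq2 q, sq3 q]"

lemma vector_4_nth [simp]:
  "(vector [x, y, z, w] :: 'a::zero ^ 4) $ 1 = x"
  "(vector [x, y, z, w] :: 'a ^ 4) $ 2 = y"
  "(vector [x, y, z, w] :: 'a ^ 4) $ 3 = z"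
  "(vector [x, y, z, w] :: 'a ^ 4) $ 4 = w"
  unfolding vector_def by simp_all

lemma Lmat_mult_coords: "Lmat q *v sq_coords x = sq_coords (q * x)"
  by (simp add: vec_eq_iff forall_4 matrix_vector_mult_def sum_4 Lmat_def sq_coords_def
      algebra_simps)

lemma Rmat_mult_coords: "Rmat q *v sq_coords x = sq_coords (x * q)"
  by (simp add: vec_eq_iff forall_4 matrix_vector_mult_def sum_4 Rmat_def sq_coords_def
      algebra_simps)

section \<open>The Moore-Penrose inverse of a matrix\<close>

definition conj_transpose :: "'a::conjugatable_field ^ 'n ^ 'm \<Rightarrow> 'a ^ 'm ^ 'n" where
  "conj_transpose A = transpose (map_matrix conjugate A)"

definition is_mp_inverse :: "'a::conjugatable_field ^ 'n ^ 'm \<Rightarrow> 'a ^ 'm ^ 'n \<Rightarrow> bool" where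
  "is_mp_inverse A X \<longleftrightarrow>
     A ** X ** A = A \<and> X ** A ** X = X \<and>
     conj_transpose (A ** X) = A ** X \<and> conj_transpose (X ** A) = X ** A"

definition mp_inverse :: "'a::conjugatable_field ^ 'n ^ 'm \<Rightarrow> 'a ^ 'm ^ 'n" where
  "mp_inverse A = (THE X. is_mp_inverse A X)"

lemma conj_transpose_mult:
  fixes A :: "'a::conjugatable_field ^ 'n ^ 'm" and B :: "'a ^ 'k ^ 'n"
  shows "conj_transpose (A ** B) = conj_transpose B ** conj_transpose A"
  by (simp add: conj_transpose_def vec_eq_iff transpose_def matrix_matrix_mult_def
      sum_conjugate conjugate_dist_mul mult.commute)

lemma is_mp_inverse_unique:
  fixes A :: "'a::conjugatable_field ^ 'n ^ 'm"
  assumes "is_mp_inverse A X" and "is_mp_inverse A Y"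
  shows "X = Y"
proof -
  note X = assms(1)[unfolded is_mp_inverse_def] and Y = assms(2)[unfolded is_mp_inverse_def]
  have "A ** X = conj_transpose ((A ** Y) ** (A ** X))"
    using X Y by (simp add: matrix_mul_assoc)
  also have "\<dots> = (A ** X) ** (A ** Y)"
    using X Y conj_transpose_mult by metis
  also have "\<dots> = A ** Y"
    using X by (simp add: matrix_mul_assoc)
  finally have AX: "A ** X = A ** Y" .
  have "X ** A = conj_transpose ((X ** A) ** (Y ** A))"
    using X Y by (metis matrix_mul_assoc)
  also have "\<dots> = (Y ** A) ** (X ** A)"
    using X Y conj_transpose_mult by metis
  also have "\<dots> = Y ** A"
    using X by (metis matrix_mul_assoc)
  finally have XA: "X ** A = Y ** A" .
  have "X = X ** (A ** X)"
    using X by (simp add: matrix_mul_assoc)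
  also have "\<dots> = Y ** (A ** Y)"
    using AX XA by (simp add: matrix_mul_assoc)
  also have "\<dots> = Y"
    using Y by (simp add: matrix_mul_assoc)
  finally show ?thesis .
qed

lemma mp_inverse_eqI: "is_mp_inverse A X \<Longrightarrow> mp_inverse A = X"
  unfolding mp_inverse_def by (blast intro: is_mp_inverse_unique)

end

theory Submission
  imports Defs
begin

text \<open>
  The split quaternions are a copy of the algebra of real \<open>2 \<times> 2\<close> matrices: send
  \<open>i\<close> to a quarter turn and \<open>j\<close>, \<open>k\<close> to two symmetric reflections.  Under that
  isomorphism \<open>q \<mapsto> q\<^sub>0 - q\<^sub>1 i - q\<^sub>2 j - q\<^sub>3 k\<close> is the adjugate, the form
  \<open>\<bar>c\<^sub>1\<bar>\<^sup>2 - \<bar>c\<^sub>2\<bar>\<^sup>2\<close> is the determinant, and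
  \<open>q \<mapsto> q\<^sub>0 - q\<^sub>1 i + q\<^sub>2 j + q\<^sub>3 k\<close>, written \<open>q\<^sup>*\<close> here, is the
  transpose.  The formula for \<open>a\<^sup>+\<close> is therefore the Moore-Penrose inverse of a
  \<open>2 \<times> 2\<close> matrix: adjugate over determinant in the invertible case, and
  \<open>a\<^sup>*\<close> divided by the trace of \<open>a a\<^sup>*\<close> in the rank-one case.  The Penrose equations
  for \<open>a\<close> and \<open>a\<^sup>+\<close> thus hold inside the algebra (\<open>sq_pinv_penrose\<close>),
  with \<open>q\<^sup>*\<close> in the role of the adjoint.

  Left multiplication is an algebra homomorphism and right multiplication an
  anti-homomorphism into \<open>4 \<times> 4\<close> matrices, and both turn \<open>q\<^sup>*\<close> into the matrix
  transpose (\<open>conj_transpose_Lmat\<close>, \<open>conj_transpose_Rmat\<close>).  The Penrose equations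
  consequently carry over to \<open>L(a)\<close> and \<open>R(a)\<close>.  Associativity says that left
  multiplications commute with right multiplications, and the Moore-Penrose inverse of a
  product is the product of the inverses when one factor and its inverse both commute with
  the other factor and its inverse (\<open>is_mp_inverse_mult_commuting\<close>).
\<close>

section \<open>Transpose and adjugate of a split quaternion\<close>

definition sq_transpose :: "squat \<Rightarrow> squat" where
  "sq_transpose q = Squat (sq0 q) (- sq1 q) (sq2 q) (sq3 q)"

definition sq_adjugate :: "squat \<Rightarrow> squat" where
  "sq_adjugate q = Squat (sq0 q) (- sq1 q) (- sq2 q) (- sq3 q)"

definition sq_det :: "squat \<Rightarrow> real" where
  "sq_det q = (sq0 q)\<^sup>2 + (sq1 q)\<^sup>2 - (sq2 q)\<^sup>2 - (sq3 q)\<^sup>2"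

lemma sq_transpose_mult: "sq_transpose (p * q) = sq_transpose q * sq_transpose p"
  by (simp add: squat_eq_iff sq_transpose_def algebra_simps)

lemma sq_transpose_transpose [simp]: "sq_transpose (sq_transpose q) = q"
  by (simp add: squat_eq_iff sq_transpose_def)

lemma sq_transpose_scaleR [simp]: "sq_transpose (r *\<^sub>R q) = r *\<^sub>R sq_transpose q"
  by (simp add: squat_eq_iff sq_transpose_def)

lemma sq_transpose_one [simp]: "sq_transpose 1 = 1"
  by (simp add: squat_eq_iff sq_transpose_def)

lemma mult_sq_adjugate: "q * sq_adjugate q = of_real (sq_det q)"
  by (simp add: squat_eq_iff sq_adjugate_def sq_det_def of_real_def power2_eq_square)

lemma sq_adjugate_mult_self: "sq_adjugate q * q = of_real (sq_det q)"
  by (simp add: squat_eq_iff sq_adjugate_def sq_det_def of_real_def power2_eq_square)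

lemma sq_adjugate_mult: "sq_adjugate (p * q) = sq_adjugate q * sq_adjugate p"
  by (simp add: squat_eq_iff sq_adjugate_def algebra_simps)

lemma add_sq_adjugate: "q + sq_adjugate q = of_real (2 * sq0 q)"
  by (simp add: squat_eq_iff sq_adjugate_def of_real_def)

text \<open>The scalar is the trace of \<open>s = a a\<^sup>*\<close> as a \<open>2 \<times> 2\<close> matrix.  It appears
  because \<open>s + adj s = tr s\<close>: multiplied by \<open>a\<close> on the right, the term \<open>adj s\<close>
  becomes \<open>adj (a\<^sup>*) (adj a) a\<close>, which vanishes with the determinant of \<open>a\<close>.\<close>

lemma mult_transpose_mult_singular:
  assumes "sq_det a = 0"
  shows "a * sq_transpose a * a = (4 * (cmod (cpart1 a))\<^sup>2) *\<^sub>R a"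
proof -
  let ?s = "a * sq_transpose a"
  have "sq_adjugate ?s * a = sq_adjugate (sq_transpose a) * (sq_adjugate a * a)"
    by (simp add: sq_adjugate_mult mult.assoc)
  also have "\<dots> = 0"
    using assms by (simp add: sq_adjugate_mult_self)
  finally have adj: "sq_adjugate ?s * a = 0" .
  have "sq0 ?s = (sq0 a)\<^sup>2 + (sq1 a)\<^sup>2 + (sq2 a)\<^sup>2 + (sq3 a)\<^sup>2"
    by (simp add: sq_transpose_def power2_eq_square)
  also have "\<dots> = 2 * (cmod (cpart1 a))\<^sup>2"
    using assms by (simp add: sq_det_def cpart1_def cmod_power2)
  finally have trace: "2 * sq0 ?s = 4 * (cmod (cpart1 a))\<^sup>2" by simp
  have "?s * a = (?s + sq_adjugate ?s) * a"
    by (simp only: distrib_right adj add_0_right)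
  also have "\<dots> = (4 * (cmod (cpart1 a))\<^sup>2) *\<^sub>R a"
    by (simp only: add_sq_adjugate trace scaleR_conv_of_real)
  finally show ?thesis .
qed

section \<open>The Penrose equations in the algebra\<close>

lemma sq_pinv_cases:
  "sq_pinv a =
    (if a = 0 then 0
     else if sq_det a \<noteq> 0 then sq_adjugate a /\<^sub>R sq_det a
     else sq_transpose a /\<^sub>R (4 * (cmod (cpart1 a))\<^sup>2))"
proof -
  have det: "(cmod (cpart1 a))\<^sup>2 - (cmod (cpart2 a))\<^sup>2 = sq_det a"
    by (simp add: cpart1_def cpart2_def cmod_power2 sq_det_def)
  have adj: "sq_of_complex (cnj (cpart1 a)) - sq_of_complex (cpart2 a) * sqj = sq_adjugate a"
    and transp: "sq_of_complex (cnj (cpart1 a)) + sq_of_complex (cpart2 a) * sqj = sq_transpose a"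
    by (simp_all add: squat_eq_iff sq_of_complex_def cpart1_def cpart2_def sqi_def sqj_def
        of_real_def sq_adjugate_def sq_transpose_def)
  show ?thesis
    unfolding sq_pinv_def Let_def det adj transp ..
qed

lemma cpart1_nonzero_if_singular:
  assumes "a \<noteq> 0" and "sq_det a = 0"
  shows "cpart1 a \<noteq> 0"
proof
  assume "cpart1 a = 0"
  then have "sq0 a = 0" "sq1 a = 0"
    by (simp_all add: cpart1_def complex_eq_iff)
  then have "(sq2 a)\<^sup>2 + (sq3 a)\<^sup>2 = - sq_det a"
    by (simp add: sq_det_def)
  with assms(2) have "(sq2 a)\<^sup>2 + (sq3 a)\<^sup>2 = 0"
    by linarith
  then have "sq2 a = 0 \<and> sq3 a = 0"
    by (simp only: sum_power2_eq_zero_iff)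
  with \<open>sq0 a = 0\<close> \<open>sq1 a = 0\<close> have "a = 0"
    by (simp add: squat_eq_iff)
  with assms(1) show False ..
qed

lemma sq_pinv_penrose:
  shows mult_pinv_mult: "a * sq_pinv a * a = a"
    and pinv_mult_pinv: "sq_pinv a * a * sq_pinv a = sq_pinv a"
    and transpose_mult_pinv: "sq_transpose (a * sq_pinv a) = a * sq_pinv a"
    and transpose_pinv_mult: "sq_transpose (sq_pinv a * a) = sq_pinv a * a"
proof -
  consider (zero) "a = 0" | (inv) "a \<noteq> 0" "sq_det a \<noteq> 0" | (sing) "a \<noteq> 0" "sq_det a = 0"
    by blast
  then have "a * sq_pinv a * a = a \<and> sq_pinv a * a * sq_pinv a = sq_pinv a \<and>
    sq_transpose (a * sq_pinv a) = a * sq_pinv a \<and> sq_transpose (sq_pinv a * a) = sq_pinv a * a"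
  proof cases
    case zero
    then show ?thesis
      by (simp add: sq_pinv_cases squat_eq_iff sq_transpose_def)
  next
    case inv
    then have "a * sq_pinv a = 1" "sq_pinv a * a = 1"
      by (simp_all add: sq_pinv_cases mult_sq_adjugate sq_adjugate_mult_self of_real_def)
    then show ?thesis by simp
  next
    case sing
    define r where "r = 4 * (cmod (cpart1 a))\<^sup>2"
    have r: "r \<noteq> 0"
      using cpart1_nonzero_if_singular[OF sing] by (simp add: r_def)
    have pinv: "sq_pinv a = sq_transpose a /\<^sub>R r"
      using sing by (simp add: sq_pinv_cases r_def)
    have 1: "a * sq_transpose a * a = r *\<^sub>R a"
      using mult_transpose_mult_singular[OF sing(2)] by (simp add: r_def)
    \<comment> \<open>transposing the previous equation\<close>
    have 2: "sq_transpose a * a * sq_transpose a = r *\<^sub>R sq_transpose a"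
      using arg_cong[OF 1, of sq_transpose] by (simp add: sq_transpose_mult mult.assoc)
    show ?thesis
      using r by (simp add: pinv 1 2 sq_transpose_mult)
  qed
  then show "a * sq_pinv a * a = a" "sq_pinv a * a * sq_pinv a = sq_pinv a"
    "sq_transpose (a * sq_pinv a) = a * sq_pinv a" "sq_transpose (sq_pinv a * a) = sq_pinv a * a"
    by blast+
qed

section \<open>The two regular representations\<close>

text \<open>Coordinate vectors exhaust \<open>\<real>\<^sup>4\<close>, so matrix identities may be checked on them,
  where they become identities between products of split quaternions.\<close>

lemma matrix_eq_on_coords:
  fixes A B :: "real ^ 4 ^ 4"
  assumes "\<And>q. A *v sq_coords q = B *v sq_coords q"
  shows "A = B"
  unfolding matrix_eq
proof
  fix x :: "real ^ 4"
  have "x = sq_coords (Squat (x $ 1) (x $ 2) (x $ 3) (x $ 4))"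
    by (simp add: vec_eq_iff forall_4 sq_coords_def)
  then show "A *v x = B *v x"
    using assms by metis
qed

lemma Lmat_mult: "Lmat (p * q) = Lmat p ** Lmat q"
  by (rule matrix_eq_on_coords)
     (simp add: Lmat_mult_coords mult.assoc flip: matrix_vector_mul_assoc)

lemma Rmat_mult: "Rmat (p * q) = Rmat q ** Rmat p"
  by (rule matrix_eq_on_coords)
     (simp add: Rmat_mult_coords mult.assoc flip: matrix_vector_mul_assoc)

lemma Lmat_Rmat_commute: "Lmat p ** Rmat q = Rmat q ** Lmat p"
  by (rule matrix_eq_on_coords)
     (simp add: Lmat_mult_coords Rmat_mult_coords mult.assoc flip: matrix_vector_mul_assoc)

lemma conj_transpose_Lmat: "conj_transpose (Lmat q) = Lmat (sq_transpose q)"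
  by (simp add: conj_transpose_def vec_eq_iff forall_4 transpose_def Lmat_def sq_transpose_def)

lemma conj_transpose_Rmat: "conj_transpose (Rmat q) = Rmat (sq_transpose q)"
  by (simp add: conj_transpose_def vec_eq_iff forall_4 transpose_def Rmat_def sq_transpose_def)

lemma is_mp_inverse_Lmat: "is_mp_inverse (Lmat a) (Lmat (sq_pinv a))"
  by (simp add: is_mp_inverse_def conj_transpose_Lmat sq_pinv_penrose flip: Lmat_mult)

lemma is_mp_inverse_Rmat: "is_mp_inverse (Rmat a) (Rmat (sq_pinv a))"
  by (simp add: is_mp_inverse_def conj_transpose_Rmat sq_pinv_penrose
      flip: Rmat_mult mult.assoc)

section \<open>Moore-Penrose inverses of commuting products\<close>

text \<open>In general \<open>(A B)\<^sup>+\<close> differs from both \<open>A\<^sup>+ B\<^sup>+\<close> and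
  \<open>B\<^sup>+ A\<^sup>+\<close>.  Here every word in the four matrices splits into a word in \<open>A, X\<close>
  times a word in \<open>B, Y\<close>; in particular \<open>A B X Y = (A X) (B Y)\<close> is a product of commuting
  self-adjoint matrices, hence self-adjoint.\<close>

lemma is_mp_inverse_mult_commuting:
  fixes A B X Y :: "'a::conjugatable_field ^ 'n ^ 'n"
  assumes A: "is_mp_inverse A X" and B: "is_mp_inverse B Y"
    and AB: "A ** B = B ** A" and AY: "A ** Y = Y ** A"
    and XB: "X ** B = B ** X" and XY: "X ** Y = Y ** X"
  shows "is_mp_inverse (A ** B) (X ** Y)"
proof -
  note A = A[unfolded is_mp_inverse_def] and B = B[unfolded is_mp_inverse_def]
  have ABXY: "(A ** B) ** (X ** Y) = (A ** X) ** (B ** Y)"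
    by (metis XB matrix_mul_assoc)
  have XYAB: "(X ** Y) ** (A ** B) = (X ** A) ** (Y ** B)"
    by (metis AY matrix_mul_assoc)
  have comm1: "(B ** Y) ** (A ** X) = (A ** X) ** (B ** Y)"
    by (metis AB AY XB XY matrix_mul_assoc)
  have comm2: "(Y ** B) ** (X ** A) = (X ** A) ** (Y ** B)"
    by (metis AB AY XB XY matrix_mul_assoc)
  have "(A ** X) ** (B ** Y) ** (A ** B) = (A ** X ** A) ** (B ** Y ** B)"
    by (metis AB AY matrix_mul_assoc)
  moreover have "(X ** A) ** (Y ** B) ** (X ** Y) = (X ** A ** X) ** (Y ** B ** Y)"
    by (metis XB XY matrix_mul_assoc)
  ultimately show ?thesis
    unfolding is_mp_inverse_def ABXY XYAB
    using A B by (simp add: conj_transpose_mult comm1 comm2)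
qed

theorem proposition3p1:
  fixes a b :: squat
  shows
   "(Lmat a ** Lmat (sq_pinv a) ** Lmat a = Lmat a \<and>
     Lmat (sq_pinv a) ** Lmat a ** Lmat (sq_pinv a) = Lmat (sq_pinv a) \<and>
     Lmat a ** Lmat (sq_pinv a) = conj_transpose (Lmat a ** Lmat (sq_pinv a)) \<and>
     Lmat (sq_pinv a) ** Lmat a = conj_transpose (Lmat (sq_pinv a) ** Lmat a)) \<and>
    (Rmat a ** Rmat (sq_pinv a) ** Rmat a = Rmat a \<and>
     Rmat (sq_pinv a) ** Rmat a ** Rmat (sq_pinv a) = Rmat (sq_pinv a) \<and>
     Rmat a ** Rmat (sq_pinv a) = conj_transpose (Rmat a ** Rmat (sq_pinv a)) \<and>
     Rmat (sq_pinv a) ** Rmat a = conj_transpose (Rmat (sq_pinv a) ** Rmat a)) \<and>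
    mp_inverse (Lmat a) = Lmat (sq_pinv a) \<and>
    mp_inverse (Rmat b) = Rmat (sq_pinv b) \<and>
    mp_inverse (Lmat a ** Rmat b) = Lmat (sq_pinv a) ** Rmat (sq_pinv b)"
proof -
  have "is_mp_inverse (Lmat a ** Rmat b) (Lmat (sq_pinv a) ** Rmat (sq_pinv b))"
    by (intro is_mp_inverse_mult_commuting is_mp_inverse_Lmat is_mp_inverse_Rmat
        Lmat_Rmat_commute)
  then show ?thesis
    using is_mp_inverse_Lmat[of a] is_mp_inverse_Rmat[of a]
      mp_inverse_eqI[OF is_mp_inverse_Lmat[of a]] mp_inverse_eqI[OF is_mp_inverse_Rmat[of b]]
      mp_inverse_eqI
    unfolding is_mp_inverse_def by metis
qed

end
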